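(* Let $\{f_n\}_{n\ge1}$ be a sequence in $\mathrm{Hol}(\mathbb{D},\mathbb{D})$ and let $R_n=f_1\circ f_2\circ\dots\circ f_n$. Suppose that there exists an infinite backward orbit $\{w_n\}_{n\ge0}$ for $\{R_n\}$. Then there exist a sequence $\{\gamma_n\}$ in $\mathrm{Aut}(\mathbb{D})$ with $\gamma_n(w_n)=w_0$ for all $n$, and a map $h\in\mathrm{Hol}(\mathbb{D},\mathbb{D})$, for which $R_n\circ\gamma_n^{-1}\to h$. Furthermore, $h$ is uniquely specified by $\{R_n\}$ and $\{w_n\}$ up to right composition by elements of $\mathrm{Aut}(\mathbb{D})$: if $\{\gamma_n\},\{\chi_n\}$ are sequences in $\mathrm{Aut}(\mathbb{D})$ with $\gamma_n(w_n)=\chi_n(w_n)=w_0$ for all $n$, and $R_n\circ\gamma_n^{-1}\to h$ and $R_n\circ\chi_n^{-1}\to g$ with $h,g\in\mathrm{Hol}(\mathbb{D},\mathbb{D})$, then $g=h\circ\alpha$ for some $\alpha\in\mathrm{Aut}(\mathbb{D})$.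
   Context: $\mathbb{D}$ is the open unit disc; $\mathrm{Hol}(\mathbb{D},\mathbb{D})$ is the space of holomorphic self-maps of $\mathbb{D}$ (constants included) and $\mathrm{Aut}(\mathbb{D})$ the group of conformal automorphisms of $\mathbb{D}$. The notation $\to$ denotes uniform convergence on compact subsets of $\mathbb{D}$. The sequence $\{R_n\}$ is the right iterated function system generated by $\{f_n\}$. A backward orbit for $\{R_n\}$ is a sequence $\{w_n\}_{n\ge 0}$ in $\mathbb{D}$ such that $f_n(w_n)=w_{n-1}$ for all $n\ge1$. *)

theory Defs
  imports "HOL-Complex_Analysis.Complex_Analysis"
begin

abbreviation unit_disc :: "complex set" where
  "unit_disc \<equiv> ball 0 1"

text \<open>
  Maps of the disc are total functions on the complex plane of which only the values on the
  disc matter; accordingly, equality of two such maps always means equality on the disc.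
\<close>

definition hol_disc :: "(complex \<Rightarrow> complex) set" where
  "hol_disc = {f. f holomorphic_on unit_disc \<and> f ` unit_disc \<subseteq> unit_disc}"

definition aut_inv :: "(complex \<Rightarrow> complex) \<Rightarrow> complex \<Rightarrow> complex" where
  "aut_inv f = inv_into unit_disc f"

definition aut_disc :: "(complex \<Rightarrow> complex) set" where
  "aut_disc = {f \<in> hol_disc. bij_betw f unit_disc unit_disc \<and> aut_inv f \<in> hol_disc}"

definition conv_compacts ::
    "(nat \<Rightarrow> complex \<Rightarrow> complex) \<Rightarrow> (complex \<Rightarrow> complex) \<Rightarrow> bool" where
  "conv_compacts F h \<longleftrightarrow>
     (\<forall>K. compact K \<and> K \<subseteq> unit_disc \<longrightarrow> uniform_limit K F h sequentially)"

text \<open>The generating sequence starts at index 1; the value \<open>f 0\<close> is never used.\<close>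

primrec right_ifs :: "(nat \<Rightarrow> complex \<Rightarrow> complex) \<Rightarrow> nat \<Rightarrow> complex \<Rightarrow> complex" where
  "right_ifs f 0 = id"
| "right_ifs f (Suc n) = right_ifs f n \<circ> f (Suc n)"

text \<open>
  A backward orbit is an infinite sequence; its points need not be distinct.
\<close>

definition backward_orbit :: "(nat \<Rightarrow> complex \<Rightarrow> complex) \<Rightarrow> (nat \<Rightarrow> complex) \<Rightarrow> bool" where
  "backward_orbit f w \<longleftrightarrow>
     (\<forall>n. w n \<in> unit_disc) \<and> (\<forall>n\<ge>1. f n (w n) = w (n - 1))"

end

theory Submission
  imports Defs
begin

text \<open>
  Conjugating with automorphisms \<open>S n\<close> that carry \<open>0\<close> to \<open>w n\<close> turns the backward orbit into a common
  fixed point: the maps \<open>G n = right_ifs f n \<circ> S n\<close> all take the same value at \<open>0\<close>, and for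
  \<open>m \<le> n\<close> one has \<open>G n = G m \<circ> \<phi>\<close> with a self-map \<open>\<phi>\<close> of the disc fixing \<open>0\<close>. So the \<open>G n\<close> form
  a decreasing chain for subordination, and the freedom left in \<open>\<gamma> n\<close> is one rotation for each \<open>n\<close>.

  Existence. By Montel's theorem subsequences of \<open>G\<close> converge. Given two subsequential limits, the
  connecting maps \<open>\<phi>\<close> also have a convergent subsequence, so each limit is subordinate to the
  other (\<open>limits_subordinate\<close>). Mutually subordinate functions differ only by a rotation, by the
  maximum modulus principle and the Schwarz lemma (\<open>subordinate_antisym\<close>). Hence the set of
  subsequential limits of \<open>G\<close> consists of rotations of one function \<open>g\<close>, and rotating each \<open>G n\<close> so
  as to bring it close to \<open>g\<close> forces the full sequence to converge to \<open>g\<close>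
  (\<open>subordinate_chain_rotations\<close>). This avoids normalising a Taylor coefficient, which would not
  determine the rotation when \<open>g\<close> has a critical point at \<open>0\<close>.

  Uniqueness. Two admissible normalisations differ by \<open>\<gamma> n \<circ> aut_inv (\<eta> n)\<close>, an automorphism that
  fixes \<open>w 0\<close>, hence a rotation up to a fixed conjugation. The circle of rotations is compact, so a
  subsequence of these automorphisms converges, and its limit is the required \<open>\<alpha>\<close>
  (\<open>normalised_limit_unique\<close>).
\<close>

section \<open>Convergence of self-maps of the disc\<close>

lemma hol_discD:
  assumes "f \<in> hol_disc"
  shows "f holomorphic_on unit_disc" and "\<And>z. z \<in> unit_disc \<Longrightarrow> f z \<in> unit_disc"
  using assms unfolding hol_disc_def by blast+

lemma hol_disc_compose:
  assumes "f \<in> hol_disc" and "g \<in> hol_disc"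
  shows "f \<circ> g \<in> hol_disc"
  using assms holomorphic_on_compose_gen[of g unit_disc f unit_disc]
  by (auto simp: hol_disc_def image_subset_iff)

text \<open>
  Evaluating at moving points is what allows pointwise passage to the limit in compositions
  \<open>G n \<circ> \<Phi> n\<close>, so that uniform convergence of compositions is never needed.
\<close>

lemma conv_compacts_tendsto:
  assumes conv: "conv_compacts G g" and g: "continuous_on unit_disc g"
    and x: "x \<longlonglongrightarrow> y" and y: "y \<in> unit_disc"
  shows "(\<lambda>n. G n (x n)) \<longlonglongrightarrow> g y"
proof -
  obtain d where d: "d > 0" "cball y d \<subseteq> unit_disc"
    using y open_contains_cball[of unit_disc] by blast
  have ul: "uniform_limit (cball y d) G g sequentially"
    using conv d by (simp add: conv_compacts_def)
  have evx: "eventually (\<lambda>n. x n \<in> cball y d) sequentially"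
    using tendstoD[OF x d(1)] by eventually_elim (simp add: dist_commute)
  have "isCont g y"
    using g y continuous_on_interior[of unit_disc g y] by simp
  then have gx: "(\<lambda>n. g (x n)) \<longlonglongrightarrow> g y"
    using x isCont_tendsto_compose by blast
  show ?thesis
  proof (rule tendstoI)
    fix e :: real assume "e > 0"
    then have "eventually (\<lambda>n. \<forall>z\<in>cball y d. dist (G n z) (g z) < e / 2) sequentially"
      using uniform_limitD[OF ul, of "e / 2"] by simp
    moreover have "eventually (\<lambda>n. dist (g (x n)) (g y) < e / 2) sequentially"
      using tendstoD[OF gx, of "e / 2"] \<open>e > 0\<close> by simp
    ultimately show "eventually (\<lambda>n. dist (G n (x n)) (g y) < e) sequentially"
      using evx by eventually_elim (metis dist_triangle_half_r dist_commute)
  qed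
qed

lemma conv_compacts_pointwise:
  assumes "conv_compacts G g" and "z \<in> unit_disc"
  shows "(\<lambda>n. G n z) \<longlonglongrightarrow> g z"
  using assms by (auto simp: conv_compacts_def dest!: spec[of _ "{z}"])

lemma conv_compacts_subseq:
  assumes "conv_compacts G g" and "strict_mono r"
  shows "conv_compacts (\<lambda>n. G (r n)) g"
  unfolding conv_compacts_def uniform_limit_iff
proof (intro allI impI)
  fix K :: "complex set" and e :: real
  assume "compact K \<and> K \<subseteq> unit_disc" and "e > 0"
  then have "eventually (\<lambda>n. \<forall>x\<in>K. dist (G n x) (g x) < e) sequentially"
    using assms(1) by (auto simp: conv_compacts_def uniform_limit_iff)
  then show "eventually (\<lambda>n. \<forall>x\<in>K. dist (G (r n) x) (g x) < e) sequentially"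
    using eventually_subseq[OF assms(2)] by blast
qed

text \<open>
  The common value at \<open>0\<close> keeps the limit a self-map of the open disc: a limit that reached the
  unit circle would be constant by the maximum modulus principle.
\<close>

lemma normal_family:
  assumes F: "\<And>n::nat. F n \<in> hol_disc" and F0: "\<And>n. F n 0 = a" and a: "a \<in> unit_disc"
  obtains g r where "g \<in> hol_disc" "g 0 = a" "strict_mono (r :: nat \<Rightarrow> nat)"
    "conv_compacts (\<lambda>n. F (r n)) g"
proof -
  have "\<exists>B. \<forall>h \<in> hol_disc. \<forall>z \<in> K. norm (h z) \<le> B" if "compact K" "K \<subseteq> unit_disc" for K
  proof (intro exI ballI)
    fix h z assume "h \<in> hol_disc" "z \<in> K"
    then show "norm (h z) \<le> 1"
      using that hol_discD(2)[of h z] by (auto simp: less_imp_le)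
  qed
  moreover have "range F \<subseteq> hol_disc" using F by auto
  ultimately obtain g r where g: "g holomorphic_on unit_disc" and r: "strict_mono (r :: nat \<Rightarrow> nat)"
    and pw: "\<And>x. x \<in> unit_disc \<Longrightarrow> (\<lambda>n. F (r n) x) \<longlonglongrightarrow> g x"
    and ul: "\<And>K. \<lbrakk>compact K; K \<subseteq> unit_disc\<rbrakk> \<Longrightarrow> uniform_limit K (F \<circ> r) g sequentially"
    using Montel[of unit_disc hol_disc F] hol_discD(1) by (metis open_ball)
  have g0: "g 0 = a"
    using pw[of 0] F0 by (simp add: LIMSEQ_const_iff)
  have le: "norm (g z) \<le> 1" if "z \<in> unit_disc" for z
    using tendsto_norm[OF pw[OF that]]
  proof (rule Lim_bounded)
    show "\<forall>n\<ge>0. norm (F (r n) z) \<le> 1"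
      using hol_discD(2)[OF F that] by (simp add: less_imp_le)
  qed
  have "g z \<in> unit_disc" if z: "z \<in> unit_disc" for z
  proof (rule ccontr)
    assume "g z \<notin> unit_disc"
    then have "g constant_on unit_disc"
      using maximum_modulus_principle[OF g open_ball connected_ball open_ball subset_refl z] le
      by force
    then have "g z = g 0"
      using z by (auto simp: constant_on_def)
    then show False using \<open>g z \<notin> unit_disc\<close> g0 a by simp
  qed
  then have "g \<in> hol_disc" using g by (auto simp: hol_disc_def)
  moreover have "conv_compacts (\<lambda>n. F (r n)) g"
    using ul by (simp add: conv_compacts_def o_def)
  ultimately show thesis using that g0 r by blast
qed

section \<open>Subordination\<close>

definition subordinate :: "(complex \<Rightarrow> complex) \<Rightarrow> (complex \<Rightarrow> complex) \<Rightarrow> bool" where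
  "subordinate h g \<longleftrightarrow> (\<exists>\<phi>\<in>hol_disc. \<phi> 0 = 0 \<and> (\<forall>z\<in>unit_disc. h z = g (\<phi> z)))"

lemma Schwarz_hol_disc:
  assumes "\<phi> \<in> hol_disc" and "\<phi> 0 = 0" and "z \<in> unit_disc"
  shows "norm (\<phi> z) \<le> norm z"
    and "z \<noteq> 0 \<Longrightarrow> norm (\<phi> z) = norm z \<Longrightarrow> \<exists>u. norm u = 1 \<and> (\<forall>y\<in>unit_disc. \<phi> y = u * y)"
proof -
  have hol: "\<phi> holomorphic_on unit_disc" and no: "\<And>z. norm z < 1 \<Longrightarrow> norm (\<phi> z) < 1"
    using hol_discD[OF assms(1)] by auto
  show "norm (\<phi> z) \<le> norm z"
    using Schwarz_Lemma(1)[OF hol assms(2) no] assms(3) by simp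
  show "\<exists>u. norm u = 1 \<and> (\<forall>y\<in>unit_disc. \<phi> y = u * y)" if "z \<noteq> 0" "norm (\<phi> z) = norm z"
    using Schwarz_Lemma(3)[OF hol assms(2) no, of z] assms(3) that
    by (metis mem_ball_0)
qed

text \<open>
  As \<open>r k \<le> s (r k)\<close> for strictly increasing \<open>s\<close>, the subsequence \<open>s \<circ> r\<close> of the second sequence lies
  further down the chain than \<open>r\<close>, term by term. A subsequential limit of the connecting maps
  witnesses the subordination.
\<close>

lemma limits_subordinate:
  fixes r s :: "nat \<Rightarrow> nat"
  assumes chain: "\<And>m n. m \<le> n \<Longrightarrow> subordinate (G n) (G m)"
    and g: "continuous_on unit_disc g"
    and r: "strict_mono r" and s: "strict_mono s"
    and Gg: "conv_compacts (\<lambda>k. G (r k)) g" and Gh: "conv_compacts (\<lambda>k. G (s k)) h"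
  shows "subordinate h g"
proof -
  have "subordinate (G (s (r k))) (G (r k))" for k
    using chain seq_suble[OF s] by blast
  then obtain \<Phi> where \<Phi>: "\<And>k. \<Phi> k \<in> hol_disc" "\<And>k. \<Phi> k 0 = 0"
    and G\<Phi>: "\<And>k z. z \<in> unit_disc \<Longrightarrow> G (s (r k)) z = G (r k) (\<Phi> k z)"
    unfolding subordinate_def by metis
  obtain \<phi> t where \<phi>: "\<phi> \<in> hol_disc" "\<phi> 0 = 0" and t: "strict_mono (t :: nat \<Rightarrow> nat)"
    and conv: "conv_compacts (\<lambda>k. \<Phi> (t k)) \<phi>"
    using normal_family[of \<Phi> 0] \<Phi> by auto
  have "h z = g (\<phi> z)" if z: "z \<in> unit_disc" for z
  proof (rule LIMSEQ_unique)
    show "(\<lambda>k. G (s (r (t k))) z) \<longlonglongrightarrow> h z"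
      using conv_compacts_pointwise[OF conv_compacts_subseq[OF Gh, of "r \<circ> t"] z]
        strict_mono_o[OF r t] by simp
    show "(\<lambda>k. G (s (r (t k))) z) \<longlonglongrightarrow> g (\<phi> z)"
      using conv_compacts_tendsto[OF conv_compacts_subseq[OF Gg t] g
          conv_compacts_pointwise[OF conv z] hol_discD(2)[OF \<phi>(1) z]] G\<Phi>[OF z] by simp
  qed
  then show ?thesis using \<phi> by (auto simp: subordinate_def)
qed

text \<open>
  From \<open>h = g \<circ> \<phi>\<close> and \<open>g = h \<circ> \<psi>\<close> follows \<open>g = g \<circ> \<phi> \<circ> \<psi>\<close>. Let \<open>p\<close> maximise the modulus of \<open>g\<close>
  on a closed disc about \<open>0\<close>. If \<open>\<phi> \<circ> \<psi>\<close> moved \<open>p\<close> into the interior of that disc, the maximum would be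
  attained there and \<open>g\<close> would be constant. Otherwise equality holds in the Schwarz lemma for \<open>\<phi>\<close>
  at \<open>\<psi> p\<close>, and \<open>\<phi>\<close> is a rotation.
\<close>

lemma subordinate_antisym:
  assumes hol: "g holomorphic_on unit_disc" and hg: "subordinate h g" and gh: "subordinate g h"
  shows "\<exists>u. norm u = 1 \<and> (\<forall>z\<in>unit_disc. h z = g (u * z))"
proof (cases "g constant_on unit_disc")
  case True
  then obtain c where c: "\<And>z. z \<in> unit_disc \<Longrightarrow> g z = c"
    by (auto simp: constant_on_def)
  have "h z = g (1 * z)" if "z \<in> unit_disc" for z
    using hg that c hol_discD(2) by (fastforce simp: subordinate_def)
  then show ?thesis by (metis norm_one)
next
  case False
  obtain \<phi> where \<phi>: "\<phi> \<in> hol_disc" "\<phi> 0 = 0" and h: "\<And>z. z \<in> unit_disc \<Longrightarrow> h z = g (\<phi> z)"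
    using hg by (auto simp: subordinate_def)
  obtain \<psi> where \<psi>: "\<psi> \<in> hol_disc" "\<psi> 0 = 0" and g: "\<And>z. z \<in> unit_disc \<Longrightarrow> g z = h (\<psi> z)"
    using gh by (auto simp: subordinate_def)
  have sub: "cball 0 (1/2) \<subseteq> unit_disc" by auto
  have sub': "ball 0 (1/2) \<subseteq> unit_disc" by (simp add: ball_subset_ball_iff)
  have "continuous_on (cball 0 (1/2)) (\<lambda>z. norm (g z))"
    using hol sub by (intro continuous_on_norm holomorphic_on_imp_continuous_on)
      (rule holomorphic_on_subset)
  then obtain p where p: "p \<in> cball 0 (1/2)"
    and pmax: "\<And>z. z \<in> cball 0 (1/2) \<Longrightarrow> norm (g z) \<le> norm (g p)"
    using continuous_attains_sup[of "cball (0::complex) (1/2)" "\<lambda>z. norm (g z)"] by auto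
  have pD: "p \<in> unit_disc" using p by auto
  have \<psi>p: "\<psi> p \<in> unit_disc" using hol_discD(2)[OF \<psi>(1) pD] .
  have gp: "g p = g (\<phi> (\<psi> p))" using g[OF pD] h[OF \<psi>p] by simp
  have "\<not> norm (\<phi> (\<psi> p)) < 1/2"
  proof
    assume "norm (\<phi> (\<psi> p)) < 1/2"
    then have "\<phi> (\<psi> p) \<in> ball 0 (1/2)" by simp
    then have "g constant_on unit_disc"
      using maximum_modulus_principle[OF hol open_ball connected_ball open_ball sub', of "\<phi> (\<psi> p)"]
        pmax gp by auto
    then show False using False by simp
  qed
  then have "norm (\<phi> (\<psi> p)) = norm (\<psi> p)" "\<psi> p \<noteq> 0"
    using Schwarz_hol_disc(1)[OF \<phi> \<psi>p] Schwarz_hol_disc(1)[OF \<psi> pD] p \<phi>(2) by auto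
  then obtain u where "norm u = 1" "\<And>y. y \<in> unit_disc \<Longrightarrow> \<phi> y = u * y"
    using Schwarz_hol_disc(2)[OF \<phi> \<psi>p] by blast
  then show ?thesis using h by metis
qed

section \<open>Choosing the rotations\<close>

text \<open>
  At stage \<open>n\<close> the choice is made for the strongest requirement with index at most \<open>n\<close> that can be met.
\<close>

lemma diagonal_choice:
  fixes P :: "nat \<Rightarrow> nat \<Rightarrow> 'a \<Rightarrow> bool"
  assumes ev: "\<And>k. eventually (\<lambda>n. \<exists>u. P k n u) sequentially"
    and mono: "\<And>j k n u. j \<le> k \<Longrightarrow> P k n u \<Longrightarrow> P j n u"
  obtains u where "\<And>k. eventually (\<lambda>n. P k n (u n)) sequentially"
proof -
  define A where "A n = {k. k \<le> n \<and> (\<exists>u. P k n u)}" for n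
  define u where "u n = (SOME u. P (Max (A n)) n u)" for n
  have fin: "finite (A n)" for n
    by (rule finite_subset[of _ "{..n}"]) (auto simp: A_def)
  have "eventually (\<lambda>n. P k n (u n)) sequentially" for k
    using ev[of k] eventually_ge_at_top[of k]
  proof eventually_elim
    case (elim n)
    then have k: "k \<in> A n" by (simp add: A_def)
    then have "Max (A n) \<in> A n" using Max_in fin by blast
    then have "P (Max (A n)) n (u n)" by (auto simp: A_def u_def intro: someI)
    moreover have "k \<le> Max (A n)" using k fin by simp
    ultimately show "P k n (u n)" by (rule mono[rotated])
  qed
  then show thesis by (rule that)
qed

lemma unimodular_mult_disc:
  fixes u z :: complex
  assumes "norm u = 1"
  shows "u * z \<in> unit_disc \<longleftrightarrow> z \<in> unit_disc"
  using assms by (simp add: norm_mult)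

lemma rotation_compose_hol_disc:
  assumes "norm u = 1" and "g \<in> hol_disc"
  shows "(\<lambda>z. g (u * z)) \<in> hol_disc"
proof -
  have "(*) u \<in> hol_disc"
    using assms(1) by (auto simp: hol_disc_def norm_mult intro!: holomorphic_intros)
  from hol_disc_compose[OF assms(2) this] show ?thesis by (simp add: o_def)
qed

text \<open>
  If for some tolerance infinitely many \<open>G n\<close> had no rotation close to \<open>g\<close>, a convergent subsequence
  of them would have a limit that is itself a rotation of \<open>g\<close>, a contradiction. The diagonal choice
  then lets the tolerance shrink while the discs of radius \<open>1 - \<epsilon> k\<close> exhaust the unit disc.
\<close>

lemma subordinate_chain_rotations:
  fixes G :: "nat \<Rightarrow> complex \<Rightarrow> complex"
  assumes G: "\<And>n. G n \<in> hol_disc" and G0: "\<And>n. G n 0 = a" and a: "a \<in> unit_disc"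
    and chain: "\<And>m n. m \<le> n \<Longrightarrow> subordinate (G n) (G m)"
  obtains g u where "g \<in> hol_disc" and "\<And>n. norm (u n) = 1"
    and "conv_compacts (\<lambda>n z. G n (u n * z)) g"
proof -
  obtain g r where g: "g \<in> hol_disc" and r: "strict_mono (r :: nat \<Rightarrow> nat)"
    and Gg: "conv_compacts (\<lambda>k. G (r k)) g"
    using normal_family[of G a] G G0 a by metis
  note gh = hol_discD(1)[OF g] and gc = holomorphic_on_imp_continuous_on[OF hol_discD(1)[OF g]]
  define \<epsilon> :: "nat \<Rightarrow> real" where "\<epsilon> k = 1 / real (Suc k)" for k
  have \<epsilon>: "\<epsilon> k > 0" for k by (simp add: \<epsilon>_def)
  have \<epsilon>_mono: "\<epsilon> k \<le> \<epsilon> j" if "j \<le> k" for j k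
    using that by (simp add: \<epsilon>_def field_simps)
  have \<epsilon>_small: "\<exists>k. \<epsilon> k < d" if "d > 0" for d
    using that by (simp add: \<epsilon>_def nat_approx_posE) (metis nat_approx_posE inverse_eq_divide of_nat_Suc)
  define P where "P k n u \<longleftrightarrow> norm u = 1 \<and>
      (\<forall>z\<in>cball 0 (1 - \<epsilon> k). dist (G n (u * z)) (g z) < \<epsilon> k)" for k n u
  have ev: "eventually (\<lambda>n. \<exists>u. P k n u) sequentially" for k
  proof (rule ccontr)
    assume "\<not> eventually (\<lambda>n. \<exists>u. P k n u) sequentially"
    then have "infinite {n. \<forall>u. \<not> P k n u}"
      by (simp add: not_eventually frequently_cofinite cofinite_eq_sequentially[symmetric])
    then obtain s :: "nat \<Rightarrow> nat" where s: "strict_mono s" and sP: "\<And>n u. \<not> P k (s n) u"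
      using infinite_enumerate by blast
    obtain h t where h: "h \<in> hol_disc" and t: "strict_mono (t :: nat \<Rightarrow> nat)"
      and Gh: "conv_compacts (\<lambda>j. G (s (t j))) h"
      using normal_family[of "\<lambda>j. G (s j)" a] G G0 a by metis
    have st: "strict_mono (\<lambda>j. s (t j))"
      using strict_mono_o[OF s t] by (simp add: o_def)
    have "subordinate h g"
      using limits_subordinate[OF chain gc r st Gg Gh] .
    moreover have "subordinate g h"
      using limits_subordinate[OF chain holomorphic_on_imp_continuous_on[OF hol_discD(1)[OF h]] st r Gh Gg] .
    ultimately obtain v where v: "norm v = 1" and hv: "\<And>z. z \<in> unit_disc \<Longrightarrow> h z = g (v * z)"
      using subordinate_antisym[OF gh] by blast
    have v0: "v \<noteq> 0" using v by auto
    have iv: "norm (inverse v) = 1" using v by (simp add: norm_inverse)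
    have "cball 0 (1 - \<epsilon> k) \<subseteq> unit_disc" using \<epsilon>[of k] by auto
    then have "uniform_limit (cball 0 (1 - \<epsilon> k)) (\<lambda>j. G (s (t j))) h sequentially"
      using Gh by (simp add: conv_compacts_def)
    from uniform_limitD[OF this \<epsilon>[of k]]
    obtain j where j: "\<And>z. z \<in> cball 0 (1 - \<epsilon> k) \<Longrightarrow> dist (G (s (t j)) z) (h z) < \<epsilon> k"
      unfolding eventually_sequentially by blast
    have "dist (G (s (t j)) (inverse v * z)) (g z) < \<epsilon> k" if z: "z \<in> cball 0 (1 - \<epsilon> k)" for z
    proof -
      have z': "inverse v * z \<in> cball 0 (1 - \<epsilon> k)" using z iv by (simp add: norm_mult)
      then have "inverse v * z \<in> unit_disc" using \<epsilon>[of k] by auto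
      then have "h (inverse v * z) = g z" using hv v0 by (simp add: field_simps)
      then show ?thesis using j[OF z'] by simp
    qed
    then have "P k (s (t j)) (inverse v)" using iv by (simp add: P_def)
    then show False using sP by blast
  qed
  have mono: "P j n u" if jk: "j \<le> k" and P: "P k n u" for j k n u
    unfolding P_def
  proof (intro conjI ballI)
    show "norm u = 1" using P by (simp add: P_def)
    fix z :: complex assume "z \<in> cball 0 (1 - \<epsilon> j)"
    then have "z \<in> cball 0 (1 - \<epsilon> k)" using \<epsilon>_mono[OF jk] by simp
    then have "dist (G n (u * z)) (g z) < \<epsilon> k" using P unfolding P_def by blast
    then show "dist (G n (u * z)) (g z) < \<epsilon> j" using \<epsilon>_mono[OF jk] by simp
  qed
  obtain v where v: "\<And>k. eventually (\<lambda>n. P k n (v n)) sequentially"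
    by (rule diagonal_choice[of P]) (rule ev, erule (1) mono, rule that)
  \<comment> \<open>The diagonal choice is unimodular only for large \<open>n\<close>; the value \<open>1\<close> fills the initial segment.\<close>
  define u where "u n = (if norm (v n) = 1 then v n else 1)" for n
  have u: "norm (u n) = 1" for n by (simp add: u_def)
  have Pu: "eventually (\<lambda>n. P k n (u n)) sequentially" for k
    using v[of k] by eventually_elim (simp add: P_def u_def)
  have "conv_compacts (\<lambda>n z. G n (u n * z)) g"
    unfolding conv_compacts_def uniform_limit_iff
  proof (intro allI impI)
    fix K :: "complex set" and e :: real
    assume K: "compact K \<and> K \<subseteq> unit_disc" and e: "e > 0"
    obtain d where d: "d > 0" "\<And>z. z \<in> K \<Longrightarrow> norm z \<le> 1 - d"
    proof (cases "K = {}")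
      case True then show thesis using that[of 1] by simp
    next
      case False
      then obtain p where p: "p \<in> K" "\<And>z. z \<in> K \<Longrightarrow> norm z \<le> norm p"
        using continuous_attains_sup[of K norm] K continuous_on_norm_id by blast
      then have "norm p < 1" using K by auto
      then show thesis using that[of "1 - norm p"] p by simp
    qed
    obtain k where k: "\<epsilon> k < min d e" using \<epsilon>_small[of "min d e"] d e by auto
    show "eventually (\<lambda>n. \<forall>z\<in>K. dist (G n (u n * z)) (g z) < e) sequentially"
      using Pu[of k]
    proof eventually_elim
      case (elim n)
      show ?case
      proof
        fix z assume "z \<in> K"
        then have "z \<in> cball 0 (1 - \<epsilon> k)" using d(2) k by fastforce
        then show "dist (G n (u n * z)) (g z) < e" using elim k unfolding P_def by fastforce
      qed
    qed
  qed
  then show thesis using that g u by blast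
qed

section \<open>Automorphisms of the disc\<close>

lemma aut_discI:
  assumes f: "f \<in> hol_disc" and g: "g \<in> hol_disc"
    and gf: "\<And>z. z \<in> unit_disc \<Longrightarrow> g (f z) = z" and fg: "\<And>z. z \<in> unit_disc \<Longrightarrow> f (g z) = z"
  shows "f \<in> aut_disc" and "\<And>z. z \<in> unit_disc \<Longrightarrow> aut_inv f z = g z"
proof -
  have bij: "bij_betw f unit_disc unit_disc"
    using hol_discD(2)[OF f] hol_discD(2)[OF g] gf fg
    by (intro bij_betw_byWitness[where f' = g]) auto
  show inv: "aut_inv f z = g z" if "z \<in> unit_disc" for z
    using bij hol_discD(2)[OF g that] fg[OF that]
    by (metis aut_inv_def bij_betw_imp_inj_on inv_into_f_f)
  then have "aut_inv f \<in> hol_disc"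
    using g holomorphic_cong[of unit_disc unit_disc "aut_inv f" g]
    by (auto simp: hol_disc_def image_subset_iff)
  then show "f \<in> aut_disc" using f bij by (simp add: aut_disc_def)
qed

lemma aut_discD:
  assumes "f \<in> aut_disc"
  shows "f \<in> hol_disc" and "aut_inv f \<in> hol_disc"
    and "\<And>z. z \<in> unit_disc \<Longrightarrow> aut_inv f (f z) = z"
    and "\<And>z. z \<in> unit_disc \<Longrightarrow> f (aut_inv f z) = z"
  using assms
  by (auto simp: aut_disc_def aut_inv_def bij_betw_def inv_into_f_f f_inv_into_f)

lemma aut_disc_transitive:
  assumes "a \<in> unit_disc"
  obtains S T where "S \<in> hol_disc" "T \<in> hol_disc" "S 0 = a" "T a = 0"
    "\<And>z. z \<in> unit_disc \<Longrightarrow> S (T z) = z" "\<And>z. z \<in> unit_disc \<Longrightarrow> T (S z) = z"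
proof -
  obtain T S where T: "T a = 0" "T holomorphic_on unit_disc" "T ` unit_disc \<subseteq> unit_disc"
    and S: "S holomorphic_on unit_disc" "S ` unit_disc \<subseteq> unit_disc"
    and TS: "\<And>z. z \<in> unit_disc \<Longrightarrow> T (S z) = z"
    and ST: "\<And>z. z \<in> unit_disc \<Longrightarrow> S (T z) = z"
    by (rule ball_biholomorphism_exists[OF assms]) blast
  have "S \<in> hol_disc" "T \<in> hol_disc" using S T by (simp_all add: hol_disc_def)
  moreover have "S 0 = a" using ST[OF assms] T(1) by simp
  ultimately show thesis using that T(1) ST TS by blast
qed

text \<open>
  Two charts are used, because \<open>\<gamma> n\<close> passes from the chart centred at \<open>w n\<close> to the one centred at
  \<open>w 0\<close>; with equal charts this gives the limit automorphism \<open>\<alpha>\<close> of the uniqueness part.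
\<close>

lemma conjugated_rotation_aut_disc:
  assumes ST: "S \<in> hol_disc" "T \<in> hol_disc" "\<And>z. z \<in> unit_disc \<Longrightarrow> S (T z) = z"
    "\<And>z. z \<in> unit_disc \<Longrightarrow> T (S z) = z"
    and ST': "S' \<in> hol_disc" "T' \<in> hol_disc" "\<And>z. z \<in> unit_disc \<Longrightarrow> S' (T' z) = z"
    "\<And>z. z \<in> unit_disc \<Longrightarrow> T' (S' z) = z"
    and u: "norm u = 1"
  shows "(\<lambda>z. S (u * T' z)) \<in> aut_disc"
    and "\<And>z. z \<in> unit_disc \<Longrightarrow> aut_inv (\<lambda>z. S (u * T' z)) z = S' (inverse u * T z)"
proof -
  have u0: "u \<noteq> 0" and iu: "norm (inverse u) = 1" using u by (auto simp: norm_inverse)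
  have 1: "(\<lambda>z. S (u * T' z)) \<in> hol_disc"
    using hol_disc_compose[OF rotation_compose_hol_disc[OF u ST(1)] ST'(2)] by (simp add: o_def)
  have 2: "(\<lambda>z. S' (inverse u * T z)) \<in> hol_disc"
    using hol_disc_compose[OF rotation_compose_hol_disc[OF iu ST'(1)] ST(2)] by (simp add: o_def)
  have 3: "S' (inverse u * T (S (u * T' z))) = z" if "z \<in> unit_disc" for z
  proof -
    have "u * T' z \<in> unit_disc"
      using hol_discD(2)[OF ST'(2) that] unimodular_mult_disc[OF u] by blast
    then show ?thesis using ST(4) ST'(3)[OF that] u0 by (simp add: mult.assoc[symmetric])
  qed
  have 4: "S (u * T' (S' (inverse u * T z))) = z" if "z \<in> unit_disc" for z
  proof -
    have "inverse u * T z \<in> unit_disc"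
      using hol_discD(2)[OF ST(2) that] unimodular_mult_disc[OF iu] by blast
    then show ?thesis using ST'(4) ST(3)[OF that] u0 by (simp add: mult.assoc[symmetric])
  qed
  show "(\<lambda>z. S (u * T' z)) \<in> aut_disc"
    using aut_discI(1)[OF 1 2 3 4] .
  show "aut_inv (\<lambda>z. S (u * T' z)) z = S' (inverse u * T z)" if "z \<in> unit_disc" for z
    using aut_discI(2)[OF 1 2 3 4 that] .
qed

text \<open>
  The Schwarz lemma for the map and for its inverse leaves only the case of equality.
\<close>

lemma aut_fixing_0_rotation:
  assumes f: "f \<in> hol_disc" "f 0 = 0" and g: "g \<in> hol_disc" "g 0 = 0"
    and gf: "\<And>z. z \<in> unit_disc \<Longrightarrow> g (f z) = z"
  shows "\<exists>u. norm u = 1 \<and> (\<forall>z\<in>unit_disc. f z = u * z)"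
proof -
  define p :: complex where "p = 1/2"
  have p: "p \<in> unit_disc" "p \<noteq> 0" by (auto simp: p_def)
  have "norm (f p) = norm p"
    using Schwarz_hol_disc(1)[OF f p(1)]
      Schwarz_hol_disc(1)[OF g hol_discD(2)[OF f(1) p(1)]] gf[OF p(1)] by simp
  then show ?thesis using Schwarz_hol_disc(2)[OF f p] by blast
qed

section \<open>Right iterated function systems with a backward orbit\<close>

text \<open>
  The inner factor \<open>C\<close> is the tail \<open>f (m + 1) \<circ> \<dots> \<circ> f n\<close>; that it carries \<open>w n\<close> to \<open>w m\<close> is what
  makes the conjugated sequence a subordination chain.
\<close>

lemma right_ifs_factor:
  assumes f: "\<And>n. n \<ge> 1 \<Longrightarrow> f n \<in> hol_disc" and w: "backward_orbit f w" and mn: "m \<le> n"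
  shows "\<exists>C\<in>hol_disc. C (w n) = w m \<and> right_ifs f n = right_ifs f m \<circ> C"
  using mn
proof (induction n rule: dec_induct)
  case base
  have "id \<in> hol_disc" by (auto simp: hol_disc_def holomorphic_on_id)
  then show ?case by (auto intro!: bexI[of _ id])
next
  case (step n)
  then obtain C where C: "C \<in> hol_disc" "C (w n) = w m" "right_ifs f n = right_ifs f m \<circ> C"
    by blast
  have "f (Suc n) (w (Suc n)) = w n"
    using w by (simp add: backward_orbit_def)
  moreover have "C \<circ> f (Suc n) \<in> hol_disc"
    using hol_disc_compose C(1) f by simp
  ultimately show ?case using C by (auto intro!: bexI[of _ "C \<circ> f (Suc n)"] simp: comp_assoc)
qed

lemma exists_normalised_limit:
  assumes f: "\<And>n. n \<ge> 1 \<Longrightarrow> f n \<in> hol_disc" and w: "backward_orbit f w"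
  obtains \<gamma> h where "h \<in> hol_disc" "\<And>n. \<gamma> n \<in> aut_disc" "\<And>n. \<gamma> n (w n) = w 0"
    "conv_compacts (\<lambda>n. right_ifs f n \<circ> aut_inv (\<gamma> n)) h"
proof -
  have wD: "w n \<in> unit_disc" for n using w by (simp add: backward_orbit_def)
  have "\<exists>S T. S \<in> hol_disc \<and> T \<in> hol_disc \<and> S 0 = w n \<and> T (w n) = 0 \<and>
      (\<forall>z\<in>unit_disc. S (T z) = z) \<and> (\<forall>z\<in>unit_disc. T (S z) = z)" for n
    using aut_disc_transitive[OF wD[of n]] by metis
  then obtain S T where S: "\<And>n. S n \<in> hol_disc" and T: "\<And>n. T n \<in> hol_disc"
    and S0: "\<And>n. S n 0 = w n" and Tw: "\<And>n. T n (w n) = 0"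
    and ST: "\<And>n z. z \<in> unit_disc \<Longrightarrow> S n (T n z) = z"
    and TS: "\<And>n z. z \<in> unit_disc \<Longrightarrow> T n (S n z) = z"
    by metis
  define G where "G n = right_ifs f n \<circ> S n" for n
  have R: "right_ifs f n \<in> hol_disc" and Rw: "right_ifs f n (w n) = w 0" for n
    using right_ifs_factor[OF f w, of 0 n] by auto
  have G: "G n \<in> hol_disc" and G0: "G n 0 = w 0" for n
    using hol_disc_compose[OF R S] by (auto simp: G_def S0 Rw)
  have chain: "subordinate (G n) (G m)" if mn: "m \<le> n" for m n
  proof -
    obtain C where C: "C \<in> hol_disc" "C (w n) = w m" "right_ifs f n = right_ifs f m \<circ> C"
      using right_ifs_factor[OF f w mn] by blast
    have "G n z = G m ((T m \<circ> C \<circ> S n) z)" if z: "z \<in> unit_disc" for z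
      using C(3) ST[OF hol_discD(2)[OF C(1) hol_discD(2)[OF S z]]] by (simp add: G_def)
    moreover have "T m \<circ> C \<circ> S n \<in> hol_disc"
      using hol_disc_compose C(1) S T by blast
    moreover have "(T m \<circ> C \<circ> S n) 0 = 0"
      by (simp add: S0 C(2) Tw)
    ultimately show ?thesis unfolding subordinate_def by blast
  qed
  obtain g u where g: "g \<in> hol_disc" and u: "\<And>n. norm (u n) = 1"
    and conv: "conv_compacts (\<lambda>n z. G n (u n * z)) g"
    by (rule subordinate_chain_rotations[of G, OF G G0 wD chain]) (assumption, rule that)
  define \<gamma> where "\<gamma> n = (\<lambda>z. S 0 (inverse (u n) * T n z))" for n
  have iu: "norm (inverse (u n)) = 1" for n using u by (simp add: norm_inverse)
  have \<gamma>: "\<gamma> n \<in> aut_disc" for n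
    using conjugated_rotation_aut_disc(1)[of "S 0" "T 0" "S n" "T n", OF S T ST TS S T ST TS iu]
    by (simp add: \<gamma>_def)
  have \<gamma>_inv: "aut_inv (\<gamma> n) z = S n (u n * T 0 z)" if "z \<in> unit_disc" for n z
    using conjugated_rotation_aut_disc(2)[of "S 0" "T 0" "S n" "T n", OF S T ST TS S T ST TS iu that]
    by (simp add: \<gamma>_def)
  have "conv_compacts (\<lambda>n. right_ifs f n \<circ> aut_inv (\<gamma> n)) (g \<circ> T 0)"
    unfolding conv_compacts_def
  proof (intro allI impI)
    fix K :: "complex set" assume K: "compact K \<and> K \<subseteq> unit_disc"
    have "compact (T 0 ` K)"
      using K hol_discD(1)[OF T] holomorphic_on_imp_continuous_on continuous_on_subset
      by (blast intro: compact_continuous_image)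
    moreover have "T 0 ` K \<subseteq> unit_disc" using K hol_discD(2)[OF T] by blast
    ultimately have "uniform_limit (T 0 ` K) (\<lambda>n z. G n (u n * z)) g sequentially"
      using conv by (simp add: conv_compacts_def)
    then have "uniform_limit K (\<lambda>n z. G n (u n * T 0 z)) (\<lambda>z. g (T 0 z)) sequentially"
      by (rule uniform_limit_compose') auto
    then show "uniform_limit K (\<lambda>n. right_ifs f n \<circ> aut_inv (\<gamma> n)) (g \<circ> T 0) sequentially"
      using K \<gamma>_inv by (subst uniform_limit_cong'[where g = "\<lambda>n z. G n (u n * T 0 z)"])
        (auto simp: G_def o_def)
  qed
  moreover have "g \<circ> T 0 \<in> hol_disc" using hol_disc_compose g T by blast
  moreover have "\<gamma> n (w n) = w 0" for n by (simp add: \<gamma>_def Tw S0)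
  ultimately show thesis using that \<gamma> by blast
qed

text \<open>
  The reason is compactness of the stabiliser of \<open>a\<close>: after conjugation to \<open>0\<close> its elements are the
  rotations, which the unit circle parametrises.
\<close>

lemma normalised_limit_unique:
  assumes a: "a \<in> unit_disc"
    and \<gamma>: "\<And>n. \<gamma> n \<in> aut_disc" "\<And>n. \<gamma> n (w n) = a"
    and \<eta>: "\<And>n. \<eta> n \<in> aut_disc" "\<And>n. \<eta> n (w n) = a"
    and w: "\<And>n. w n \<in> unit_disc"
    and h: "continuous_on unit_disc h"
    and conv_h: "conv_compacts (\<lambda>n. R n \<circ> aut_inv (\<gamma> n)) h"
    and conv_g: "conv_compacts (\<lambda>n. R n \<circ> aut_inv (\<eta> n)) g"
  shows "\<exists>\<alpha>\<in>aut_disc. \<forall>z\<in>unit_disc. g z = h (\<alpha> z)"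
proof -
  obtain S T where S: "S \<in> hol_disc" and T: "T \<in> hol_disc" and S0: "S 0 = a" and Ta: "T a = 0"
    and ST: "\<And>z. z \<in> unit_disc \<Longrightarrow> S (T z) = z" and TS: "\<And>z. z \<in> unit_disc \<Longrightarrow> T (S z) = z"
    by (rule aut_disc_transitive[OF a]) (rule that)
  note D = hol_discD(2)[OF S] hol_discD(2)[OF T] hol_discD(2)[OF aut_discD(1)[OF \<gamma>(1)]]
    hol_discD(2)[OF aut_discD(1)[OF \<eta>(1)]] hol_discD(2)[OF aut_discD(2)[OF \<gamma>(1)]]
    hol_discD(2)[OF aut_discD(2)[OF \<eta>(1)]]
  have inv_a: "aut_inv (\<gamma> n) a = w n" "aut_inv (\<eta> n) a = w n" for n
    using aut_discD(3)[OF \<gamma>(1) w] aut_discD(3)[OF \<eta>(1) w] \<gamma>(2) \<eta>(2) by metis+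
  have "\<exists>u. norm u = 1 \<and> (\<forall>z\<in>unit_disc. (T \<circ> (\<gamma> n \<circ> (aut_inv (\<eta> n) \<circ> S))) z = u * z)" for n
  proof (rule aut_fixing_0_rotation)
    show "T \<circ> (\<gamma> n \<circ> (aut_inv (\<eta> n) \<circ> S)) \<in> hol_disc"
      "T \<circ> (\<eta> n \<circ> (aut_inv (\<gamma> n) \<circ> S)) \<in> hol_disc"
      by (intro hol_disc_compose S T aut_discD(1,2)[OF \<gamma>(1)] aut_discD(1,2)[OF \<eta>(1)])+
    show "(T \<circ> (\<gamma> n \<circ> (aut_inv (\<eta> n) \<circ> S))) 0 = 0" "(T \<circ> (\<eta> n \<circ> (aut_inv (\<gamma> n) \<circ> S))) 0 = 0"
      by (simp_all add: S0 inv_a \<gamma>(2) \<eta>(2) Ta)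
    show "(T \<circ> (\<eta> n \<circ> (aut_inv (\<gamma> n) \<circ> S))) ((T \<circ> (\<gamma> n \<circ> (aut_inv (\<eta> n) \<circ> S))) z) = z"
      if "z \<in> unit_disc" for z
      using that D ST TS aut_discD(3)[OF \<gamma>(1)] aut_discD(4)[OF \<eta>(1)]
      by (simp del: mem_ball mem_ball_0)
  qed
  then obtain u where u: "\<And>n. norm (u n) = 1"
    and rot: "\<And>n z. z \<in> unit_disc \<Longrightarrow> T (\<gamma> n (aut_inv (\<eta> n) (S z))) = u n * z"
    unfolding o_def by metis
  have "\<forall>n. u n \<in> sphere 0 1" using u by simp
  then obtain v r where v: "v \<in> sphere 0 1" and r: "strict_mono (r :: nat \<Rightarrow> nat)"
    and ur: "(u \<circ> r) \<longlonglongrightarrow> v"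
    using compact_sphere[of "0::complex" 1] unfolding compact_def by blast
  have v1: "norm v = 1" using v by simp
  define \<alpha> where "\<alpha> z = S (v * T z)" for z
  have \<alpha>: "\<alpha> \<in> aut_disc"
    using conjugated_rotation_aut_disc(1)[OF S T ST TS S T ST TS v1] by (simp add: \<alpha>_def[abs_def])
  have "g z = h (\<alpha> z)" if z: "z \<in> unit_disc" for z
  proof (rule LIMSEQ_unique)
    have vT: "v * T z \<in> unit_disc"
      using D(2)[OF z] unimodular_mult_disc[OF v1] by blast
    have "isCont S (v * T z)"
      using continuous_on_interior[of unit_disc S "v * T z"] vT
        holomorphic_on_imp_continuous_on[OF hol_discD(1)[OF S]] by simp
    moreover have "(\<lambda>k. u (r k) * T z) \<longlonglongrightarrow> v * T z"
      using ur by (intro tendsto_mult_right) (simp add: o_def)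
    ultimately have lim: "(\<lambda>k. S (u (r k) * T z)) \<longlonglongrightarrow> \<alpha> z"
      unfolding \<alpha>_def by (rule isCont_tendsto_compose)
    have "S (u n * T z) = \<gamma> n (aut_inv (\<eta> n) z)" for n
      using rot[OF D(2)[OF z], of n] ST z D by (metis (no_types))
    then have "aut_inv (\<gamma> n) (S (u n * T z)) = aut_inv (\<eta> n) z" for n
      using aut_discD(3)[OF \<gamma>(1)] D(6)[OF z] by simp
    then show "(\<lambda>k. R (r k) (aut_inv (\<eta> (r k)) z)) \<longlonglongrightarrow> h (\<alpha> z)"
      using conv_compacts_tendsto[OF conv_compacts_subseq[OF conv_h r] h lim]
        hol_discD(2)[OF aut_discD(1)[OF \<alpha>] z] by simp
    show "(\<lambda>k. R (r k) (aut_inv (\<eta> (r k)) z)) \<longlonglongrightarrow> g z"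
      using conv_compacts_pointwise[OF conv_compacts_subseq[OF conv_g r] z] by simp
  qed
  then show ?thesis using \<alpha> by blast
qed

theorem theoremJ:
  fixes f :: "nat \<Rightarrow> complex \<Rightarrow> complex" and w :: "nat \<Rightarrow> complex"
  assumes "\<forall>n\<ge>1. f n \<in> hol_disc"
    and "backward_orbit f w"
  shows "(\<exists>\<gamma> :: nat \<Rightarrow> complex \<Rightarrow> complex. \<exists>h \<in> hol_disc.
            (\<forall>n\<ge>1. \<gamma> n \<in> aut_disc \<and> \<gamma> n (w n) = w 0) \<and>
            conv_compacts (\<lambda>n. right_ifs f n \<circ> aut_inv (\<gamma> n)) h)
       \<and> (\<forall>(\<gamma> :: nat \<Rightarrow> complex \<Rightarrow> complex) (\<eta> :: nat \<Rightarrow> complex \<Rightarrow> complex).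
            \<forall>h \<in> hol_disc. \<forall>g \<in> hol_disc.
              (\<forall>n\<ge>1. \<gamma> n \<in> aut_disc \<and> \<gamma> n (w n) = w 0) \<longrightarrow>
              (\<forall>n\<ge>1. \<eta> n \<in> aut_disc \<and> \<eta> n (w n) = w 0) \<longrightarrow>
              conv_compacts (\<lambda>n. right_ifs f n \<circ> aut_inv (\<gamma> n)) h \<longrightarrow>
              conv_compacts (\<lambda>n. right_ifs f n \<circ> aut_inv (\<eta> n)) g \<longrightarrow>
              (\<exists>\<alpha> \<in> aut_disc. \<forall>z \<in> unit_disc. g z = h (\<alpha> z)))"
proof -
  note f = assms(1)[rule_format]
  note w = assms(2)
  have wD: "w n \<in> unit_disc" for n using w by (simp add: backward_orbit_def)
  obtain \<gamma> h where "h \<in> hol_disc" "\<And>n. \<gamma> n \<in> aut_disc" "\<And>n. \<gamma> n (w n) = w 0"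
    "conv_compacts (\<lambda>n. right_ifs f n \<circ> aut_inv (\<gamma> n)) h"
    by (rule exists_normalised_limit[OF f w]) (assumption, rule that)
  moreover have "\<exists>\<alpha>\<in>aut_disc. \<forall>z\<in>unit_disc. g z = h (\<alpha> z)"
    if "h \<in> hol_disc"
      and \<gamma>: "\<forall>n\<ge>1. \<gamma> n \<in> aut_disc \<and> \<gamma> n (w n) = w 0"
      and \<eta>: "\<forall>n\<ge>1. \<eta> n \<in> aut_disc \<and> \<eta> n (w n) = w 0"
      and conv: "conv_compacts (\<lambda>n. right_ifs f n \<circ> aut_inv (\<gamma> n)) h"
        "conv_compacts (\<lambda>n. right_ifs f n \<circ> aut_inv (\<eta> n)) g"
    for \<gamma> \<eta> :: "nat \<Rightarrow> complex \<Rightarrow> complex" and h g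
  proof (rule normalised_limit_unique)
    show "continuous_on unit_disc h"
      using hol_discD(1)[OF that(1)] by (rule holomorphic_on_imp_continuous_on)
    show "conv_compacts (\<lambda>n. right_ifs f (Suc n) \<circ> aut_inv (\<gamma> (Suc n))) h"
      "conv_compacts (\<lambda>n. right_ifs f (Suc n) \<circ> aut_inv (\<eta> (Suc n))) g"
      \<comment> \<open>The hypotheses start at index \<open>1\<close>, so the sequences are shifted by one.\<close>
      using conv_compacts_subseq[OF conv(1), of Suc] conv_compacts_subseq[OF conv(2), of Suc]
      by (simp_all add: strict_mono_Suc_iff)
  qed (use \<gamma> \<eta> wD in auto)
  ultimately show ?thesis by blast
qed

end
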